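(* Let $\alpha\in\mathrm{int}\,C^*$, $\beta\in\mathrm{int}\,K^*$, let $A:X\to Y^*$ be a linear operator, and consider the two-player zero-sum game $G=(\alpha,\beta,A)$, i.e. the game with strategy sets $S=\{x\in C:\langle\alpha,x\rangle=1\}$, $T=\{y\in K:\langle y,\beta\rangle=1\}$ and payoff $u(x,y)=\langle y,Ax\rangle$, with finite lower and upper values $\underline v,\overline v$. Then $\underline v=\overline v$, and the set $\mathcal B^{I}\times\mathcal B^{II}$ of Nash equilibria is non-empty, convex and bounded.
   Context: $X$ and $Y$ are real reflexive Banach spaces with continuous duals $X^*$, $Y^*$; $\langle w,x\rangle$ ($w\in X^*,x\in X$) and $\langle y,z\rangle$ ($y\in Y,z\in Y^*$) are the canonical pairings; all spaces carry their norm topologies. A convex cone is a set $C$ with $\lambda C\subseteq C$ for all $\lambda\ge0$ and $\kappa C+(1-\kappa)C\subseteq C$ for all $\kappa\in[0,1]$. $C\subseteq X$ and $K\subseteq Y$ are closed convex cones, with dual cones $C^*=\{w\in X^*:\langle w,x\rangle\ge0\ \forall x\in C\}$ and $K^*=\{z\in Y^*:\langle y,z\rangle\ge0\ \forall y\in K\}$, both assumed to have non-empty interior. The linear operator $A$ is assumed to have an adjoint: for every $y\in Y$ there is a unique $A^*y\in X^*$ with $\langle A^*y,x\rangle=\langle y,Ax\rangle$ for all $x\in X$. Strategy sets are non-empty (part of the definition). Player I maximizes $u$ over $x\in S$, player II minimizes $u$ over $y\in T$. $\underline v=\sup_{x\in S}\inf_{y\in T}u(x,y)$, $\overline v=\inf_{y\in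 T}\sup_{x\in S}u(x,y)$; when they coincide the common number is the value $v$. $\mathcal B^I=\{x\in S:u(x,y)\ge v\ \forall y\in T\}$ and $\mathcal B^{II}=\{y\in T:u(x,y)\le v\ \forall x\in S\}$ are the sets of optimal strategies. A Nash equilibrium (saddle point) is $(x^*,y^* )\in S\times T$ with $u(x^*,y)\ge u(x^*,y^* )\ge u(x,y^* )$ for all $x\in S,y\in T$. *)

theory Defs
  imports "HOL-Analysis.Analysis"
begin

text \<open>
  The continuous dual of a real normed space \<open>'a\<close> is the type \<open>'a \<Rightarrow>\<^sub>L real\<close> with the operator norm;
  the canonical pairing of a vector \<open>x\<close> with a functional \<open>w\<close> is \<open>blinfun_apply w x\<close>.
\<close>

text \<open>Surjectivity of the canonical embedding into the bidual. The type argument carries the space.\<close>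

definition reflexive_space :: "'a::real_normed_vector itself \<Rightarrow> bool" where
  "reflexive_space _ \<longleftrightarrow>
     (\<forall>\<phi> :: ('a \<Rightarrow>\<^sub>L real) \<Rightarrow>\<^sub>L real. \<exists>x::'a. \<forall>w. blinfun_apply \<phi> w = blinfun_apply w x)"

text \<open>
  The cones are described by the library's \<^const>\<open>cone\<close> and \<^const>\<open>convex\<close>; the library's
  \<^const>\<open>convex_cone\<close> additionally demands non-emptiness.
\<close>

definition dual_cone :: "'a::real_normed_vector set \<Rightarrow> ('a \<Rightarrow>\<^sub>L real) set" where
  "dual_cone C = {w. \<forall>x\<in>C. 0 \<le> blinfun_apply w x}"

definition has_adjoint ::
  "('a::real_normed_vector \<Rightarrow> ('b::real_normed_vector \<Rightarrow>\<^sub>L real)) \<Rightarrow> bool" where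
  "has_adjoint A \<longleftrightarrow>
     (\<forall>y. \<exists>!w :: 'a \<Rightarrow>\<^sub>L real. \<forall>x. blinfun_apply w x = blinfun_apply (A x) y)"

definition cone_strategies ::
  "'a::real_normed_vector set \<Rightarrow> ('a \<Rightarrow>\<^sub>L real) \<Rightarrow> 'a set" where
  "cone_strategies C \<alpha> = {x\<in>C. blinfun_apply \<alpha> x = 1}"

definition payoff ::
  "('a::real_normed_vector \<Rightarrow> ('b::real_normed_vector \<Rightarrow>\<^sub>L real)) \<Rightarrow> 'a \<Rightarrow> 'b \<Rightarrow> real" where
  "payoff A x y = blinfun_apply (A x) y"

text \<open>
  Lower and upper values are extended reals, since suprema and infima of unbounded sets of reals
  are unspecified.
\<close>

definition lower_value :: "'a set \<Rightarrow> 'b set \<Rightarrow> ('a \<Rightarrow> 'b \<Rightarrow> real) \<Rightarrow> ereal" where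
  "lower_value S T u = (SUP x\<in>S. INF y\<in>T. ereal (u x y))"

definition upper_value :: "'a set \<Rightarrow> 'b set \<Rightarrow> ('a \<Rightarrow> 'b \<Rightarrow> real) \<Rightarrow> ereal" where
  "upper_value S T u = (INF y\<in>T. SUP x\<in>S. ereal (u x y))"

text \<open>Unspecified unless the lower and upper values are finite and coincide.\<close>

definition game_value :: "'a set \<Rightarrow> 'b set \<Rightarrow> ('a \<Rightarrow> 'b \<Rightarrow> real) \<Rightarrow> real" where
  "game_value S T u = (THE v. lower_value S T u = ereal v \<and> upper_value S T u = ereal v)"

definition optimal_I :: "'a set \<Rightarrow> 'b set \<Rightarrow> ('a \<Rightarrow> 'b \<Rightarrow> real) \<Rightarrow> 'a set" where
  "optimal_I S T u = {x\<in>S. \<forall>y\<in>T. u x y \<ge> game_value S T u}"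

definition optimal_II :: "'a set \<Rightarrow> 'b set \<Rightarrow> ('a \<Rightarrow> 'b \<Rightarrow> real) \<Rightarrow> 'b set" where
  "optimal_II S T u = {y\<in>T. \<forall>x\<in>S. u x y \<le> game_value S T u}"

definition nash_equilibria :: "'a set \<Rightarrow> 'b set \<Rightarrow> ('a \<Rightarrow> 'b \<Rightarrow> real) \<Rightarrow> ('a \<times> 'b) set" where
  "nash_equilibria S T u =
     {(x', y') \<in> S \<times> T. \<forall>x\<in>S. \<forall>y\<in>T. u x' y \<ge> u x' y' \<and> u x' y' \<ge> u x y'}"

end

theory Submission
  imports Defs
begin

text \<open>
  Fix \<open>v\<close> to be the upper value. For every \<open>y \<in> T\<close> and \<open>c < v\<close> the first player has some
  \<open>x \<in> S\<close> with \<open>c < u x y\<close>. Two facts turn these separate replies into a single strategy \<open>x\<close> with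
  \<open>v \<le> u x y\<close> for all \<open>y \<in> T\<close> (\<open>ex_guaranteeing_strategy\<close>).

  Algebraically, for finitely many \<open>y\<close> a common \<open>x\<close> exists (\<open>finite_minimax\<close>). For two of them this
  is a separation argument in the plane: if the convex set of payoff pairs missed the open quadrant
  above \<open>(c, c)\<close>, a convex combination of the two strategies would hold the first player down to
  \<open>c\<close>. Induction on the number of strategies replaces \<open>S\<close> by its convex subset on which one of the
  payoffs exceeds \<open>c\<close>, so no separation in higher dimension is needed.

  Topologically, \<open>S\<close> is weakly compact. It is bounded because \<open>\<alpha>\<close> is interior to the dual cone:
  \<open>\<alpha> - e w\<close> still lies in the dual cone for \<open>norm w \<le> 1\<close> and a small \<open>e > 0\<close>, so
  \<open>w x \<le> 1 / e\<close> on \<open>S\<close>. A closed bounded convex set in a reflexive space is weakly compact by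
  Tychonoff's theorem together with the separation of points from closed convex sets. The payoff
  is weakly continuous in \<open>x\<close> because of the adjoint, so the finite intersection property applies.

  Hence the lower value is at least \<open>v\<close>, and the values agree. The same argument for the second
  player, with payoff \<open>- u\<close>, yields an optimal \<open>y\<close>. Convexity and boundedness of the optimal sets
  are then immediate, and so is the description of the Nash equilibria as their product.

  Every separation result used here comes from the Mazur--Orlicz form of the Hahn--Banach theorem,
  which is proved by taking a minimal sublinear functional below a given one (Zorn) and
  observing that minimality forces linearity.
\<close>

section \<open>Sublinear functionals and the Mazur--Orlicz theorem\<close>

text \<open>Real-valued, subadditive and positively homogeneous; taking \<open>t = 0\<close> includes \<open>q 0 = 0\<close>.\<close>

definition sublinear :: "('a::real_vector \<Rightarrow> real) \<Rightarrow> bool" where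
  "sublinear q \<longleftrightarrow>
     (\<forall>x y. q (x + y) \<le> q x + q y) \<and> (\<forall>t\<ge>0. \<forall>x. q (t *\<^sub>R x) = t * q x)"

lemma sublinear_add: "sublinear q \<Longrightarrow> q (x + y) \<le> q x + q y"
  by (simp add: sublinear_def)

lemma sublinear_scale: "sublinear q \<Longrightarrow> 0 \<le> t \<Longrightarrow> q (t *\<^sub>R x) = t * q x"
  by (simp add: sublinear_def)

lemma sublinear_zero: "sublinear q \<Longrightarrow> q 0 = 0"
  using sublinear_scale[of q 0 0] by simp

lemma sublinear_minus_le: "sublinear q \<Longrightarrow> - q (- x) \<le> q x"
  using sublinear_add[of q x "- x"] sublinear_zero[of q] by simp

lemma sublinear_diff_le: "sublinear q \<Longrightarrow> q y - q (- x) \<le> q (x + y)"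
  using sublinear_add[of q "x + y" "- x"] by simp

lemma sublinearI:
  assumes add: "\<And>x y. q (x + y) \<le> q x + q y"
    and zero: "q 0 = 0"
    and scale: "\<And>t x. 0 < t \<Longrightarrow> q (t *\<^sub>R x) \<le> t * q x"
  shows "sublinear q"
proof -
  have "q (t *\<^sub>R x) = t * q x" if "0 \<le> t" for t x
  proof (cases "t = 0")
    case False
    with that have t: "0 < t" by simp
    have "t * q x = t * q (inverse t *\<^sub>R (t *\<^sub>R x))"
      using t by simp
    also have "\<dots> \<le> t * (inverse t * q (t *\<^sub>R x))"
      using t by (intro mult_left_mono scale) auto
    finally have "t * q x \<le> q (t *\<^sub>R x)"
      using t by (simp add: field_simps)
    with scale[OF t, of x] show ?thesis by simp
  qed (simp add: zero)
  with add show ?thesis by (simp add: sublinear_def)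
qed

lemma sublinear_norm: "sublinear (norm :: 'a::real_normed_vector \<Rightarrow> real)"
  by (simp add: sublinear_def norm_triangle_ineq)

text \<open>
  The basic step of the construction: a sublinear \<open>q\<close> that is at least \<open>c\<close> on a convex set \<open>D\<close> can
  be lowered to \<open>p x = (INF t\<ge>0. INF y\<in>D. q (x + t *\<^sub>R y) - t * c)\<close>, after which every linear
  functional below \<open>p\<close> is at least \<open>c\<close> on \<open>D\<close>. It is used both for \<open>D\<close> itself and, with \<open>D = {y}\<close>
  and \<open>c = q y\<close>, to show that minimal sublinear functionals are linear.
\<close>

lemma sublinear_below_on_convex:
  fixes q :: "'a::real_vector \<Rightarrow> real"
  assumes q: "sublinear q" and "convex D" "D \<noteq> {}" and c: "\<And>y. y \<in> D \<Longrightarrow> c \<le> q y"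
  obtains p where "sublinear p" "\<And>x. p x \<le> q x" "\<And>y. y \<in> D \<Longrightarrow> p (- y) \<le> - c"
proof
  define I where "I = {0::real..} \<times> D"
  define h where "h x i = q (x + fst i *\<^sub>R snd i) - fst i * c" for x i
  define p where "p x = (INF i\<in>I. h x i)" for x
  have I: "I \<noteq> {}" using \<open>D \<noteq> {}\<close> by (auto simp: I_def)
  have lower: "- q (- x) \<le> h x i" if iI: "i \<in> I" for x i
  proof -
    obtain t y where i: "i = (t, y)" "0 \<le> t" "y \<in> D"
      using iI by (auto simp: I_def)
    have "t * c - q (- x) \<le> t * q y - q (- x)"
      using c[OF i(3)] i(2) by (simp add: mult_left_mono)
    also have "\<dots> \<le> q (x + t *\<^sub>R y)"
      using sublinear_diff_le[OF q, of "t *\<^sub>R y" x] i by (simp add: sublinear_scale[OF q])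
    finally show ?thesis by (simp add: h_def i)
  qed
  have bdd: "bdd_below (h x ` I)" for x
    using lower by (auto intro!: bdd_belowI2)
  have p_le: "p x \<le> q (x + t *\<^sub>R y) - t * c" if "0 \<le> t" "y \<in> D" for x t y
    using cINF_lower[OF bdd, of "(t, y)" x] that by (auto simp: p_def I_def h_def)
  have p_ge: "m \<le> p x" if "\<And>t y. 0 \<le> t \<Longrightarrow> y \<in> D \<Longrightarrow> m \<le> q (x + t *\<^sub>R y) - t * c" for m x
    unfolding p_def using I by (rule cINF_greatest) (auto simp: I_def h_def that)
  obtain d where d: "d \<in> D" using \<open>D \<noteq> {}\<close> by blast
  show le: "p x \<le> q x" for x
    using p_le[of 0 d x] d by simp
  show "p (- y) \<le> - c" if "y \<in> D" for y
    using p_le[of 1 y "- y"] that by (simp add: sublinear_zero[OF q])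
  show "sublinear p"
  proof (rule sublinearI)
    fix x1 x2
    have *: "p (x1 + x2) \<le> (q (x1 + t *\<^sub>R y) - t * c) + (q (x2 + s *\<^sub>R z) - s * c)"
      if tyz: "0 \<le> t" "y \<in> D" "0 \<le> s" "z \<in> D" for t y s z
    proof -
      \<comment> \<open>Convexity of \<open>D\<close> merges two admissible shifts into one.\<close>
      obtain w where w: "w \<in> D" "(t + s) *\<^sub>R w = t *\<^sub>R y + s *\<^sub>R z"
      proof (cases "t + s = 0")
        case True
        with tyz have "t = 0" "s = 0" by auto
        with tyz show ?thesis by (intro that[of y]) auto
      next
        case False
        with tyz have ts: "0 < t + s" by auto
        have "(t / (t + s)) *\<^sub>R y + (s / (t + s)) *\<^sub>R z \<in> D"
          using ts tyz \<open>convex D\<close>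
          by (intro convexD) (auto simp: add_divide_distrib[symmetric])
        then show ?thesis
          using ts by (intro that) (auto simp: scaleR_right_distrib)
      qed
      have "p (x1 + x2) \<le> q (x1 + x2 + (t + s) *\<^sub>R w) - (t + s) * c"
        using tyz w by (intro p_le) auto
      also have "x1 + x2 + (t + s) *\<^sub>R w = (x1 + t *\<^sub>R y) + (x2 + s *\<^sub>R z)"
        by (simp add: w)
      also have "q \<dots> \<le> q (x1 + t *\<^sub>R y) + q (x2 + s *\<^sub>R z)"
        by (rule sublinear_add[OF q])
      finally show ?thesis by (simp add: algebra_simps)
    qed
    have "p (x1 + x2) - (q (x1 + t *\<^sub>R y) - t * c) \<le> p x2" if "0 \<le> t" "y \<in> D" for t y
    proof (rule p_ge)
      fix s z assume "(0::real) \<le> s" "z \<in> D"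
      from *[OF that this] show "p (x1 + x2) - (q (x1 + t *\<^sub>R y) - t * c) \<le> q (x2 + s *\<^sub>R z) - s * c"
        by linarith
    qed
    then have "p (x1 + x2) - p x2 \<le> p x1"
      by (intro p_ge) (simp add: algebra_simps)
    then show "p (x1 + x2) \<le> p x1 + p x2" by simp
  next
    have "0 \<le> p 0"
    proof (rule p_ge)
      show "0 \<le> q (0 + t *\<^sub>R y) - t * c" if "0 \<le> t" "y \<in> D" for t y
        using that c[of y] by (simp add: sublinear_scale[OF q] mult_left_mono)
    qed
    with le[of 0] show "p 0 = 0" by (simp add: sublinear_zero[OF q])
  next
    fix r x assume r: "(0::real) < r"
    have "p (r *\<^sub>R x) / r \<le> p x"
    proof (rule p_ge)
      fix t y assume t: "(0::real) \<le> t" "y \<in> D"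
      have "p (r *\<^sub>R x) \<le> q (r *\<^sub>R x + (r * t) *\<^sub>R y) - (r * t) * c"
        using r t by (intro p_le) auto
      also have "r *\<^sub>R x + (r * t) *\<^sub>R y = r *\<^sub>R (x + t *\<^sub>R y)"
        by (simp add: scaleR_right_distrib)
      also have "q \<dots> = r * q (x + t *\<^sub>R y)"
        using r by (simp add: sublinear_scale[OF q])
      finally show "p (r *\<^sub>R x) / r \<le> q (x + t *\<^sub>R y) - t * c"
        using r by (simp add: field_simps)
    qed
    then show "p (r *\<^sub>R x) \<le> r * p x"
      using r by (simp add: field_simps)
  qed
qed

lemma ex_minimal_sublinear:
  fixes q :: "'a::real_vector \<Rightarrow> real"
  assumes q: "sublinear q"
  obtains m where "sublinear m" "\<And>x. m x \<le> q x"
    "\<And>p. sublinear p \<Longrightarrow> (\<And>x. p x \<le> m x) \<Longrightarrow> p = m"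
proof -
  define Q where "Q = {p. sublinear p \<and> (\<forall>x. p x \<le> q x)}"
  define P where "P = (\<lambda>p p' :: 'a \<Rightarrow> real. \<forall>x. p' x \<le> p x)"
  have "\<exists>m\<in>Q. \<forall>p\<in>Q. P m p \<longrightarrow> p = m"
  proof (rule predicate_Zorn)
    show "partial_order_on Q (relation_of P Q)"
      unfolding P_def
      by (rule partial_order_on_relation_ofI) (simp, meson order_trans, meson antisym ext)
  next
    fix Ch assume "Ch \<in> Chains (relation_of P Q)"
    then have ChQ: "p \<in> Q" and chain: "P p p' \<or> P p' p" if "p \<in> Ch" "p' \<in> Ch" for p p'
      using that by (auto simp: Chains_def relation_of_def)
    show "\<exists>m\<in>Q. \<forall>p\<in>Ch. P p m"
    proof (cases "Ch = {}")
      case True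
      with q show ?thesis by (auto simp: Q_def)
    next
      case False
      have sub: "sublinear p" and le: "p x \<le> q x" if "p \<in> Ch" for p x
        using ChQ[OF that that] by (auto simp: Q_def)
      \<comment> \<open>The pointwise infimum of the chain is finite, since \<open>- q (- x)\<close> bounds all \<open>p x\<close> below.\<close>
      define m where "m x = (INF p\<in>Ch. p x)" for x
      have "- q (- x) \<le> p x" if "p \<in> Ch" for p x
        using sublinear_minus_le[OF sub[OF that], of x] le[OF that, of "- x"] by simp
      then have bdd: "bdd_below ((\<lambda>p. p x) ` Ch)" for x
        by (auto intro!: bdd_belowI2)
      have m_le: "m x \<le> p x" if "p \<in> Ch" for p x
        unfolding m_def using bdd that by (rule cINF_lower)
      have m_ge: "a \<le> m x" if "\<And>p. p \<in> Ch \<Longrightarrow> a \<le> p x" for a x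
        unfolding m_def using False that by (rule cINF_greatest)
      have "sublinear m"
      proof (rule sublinearI)
        fix x y
        have *: "m (x + y) \<le> p x + p' y" if pp: "p \<in> Ch" "p' \<in> Ch" for p p'
        proof -
          obtain r where r: "r \<in> Ch" "\<And>z. r z \<le> p z" "\<And>z. r z \<le> p' z"
            using chain[OF pp] pp unfolding P_def by blast
          have "m (x + y) \<le> r (x + y)" by (rule m_le[OF r(1)])
          also have "\<dots> \<le> r x + r y" by (rule sublinear_add[OF sub[OF r(1)]])
          finally show ?thesis using r(2)[of x] r(3)[of y] by linarith
        qed
        have "m (x + y) - p x \<le> m y" if "p \<in> Ch" for p
        proof (rule m_ge)
          fix p' assume "p' \<in> Ch"
          from *[OF that this] show "m (x + y) - p x \<le> p' y" by linarith
        qed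
        then have "m (x + y) - m y \<le> m x"
          by (intro m_ge) (simp add: algebra_simps)
        then show "m (x + y) \<le> m x + m y" by simp
      next
        have "m 0 = (INF p\<in>Ch. 0)"
          unfolding m_def by (rule INF_cong[OF refl]) (rule sublinear_zero[OF sub])
        then show "m 0 = 0" using False by simp
      next
        fix t x assume t: "(0::real) < t"
        have "m (t *\<^sub>R x) / t \<le> m x"
        proof (rule m_ge)
          fix p assume p: "p \<in> Ch"
          have "m (t *\<^sub>R x) \<le> t * p x"
            using m_le[OF p, of "t *\<^sub>R x"] sublinear_scale[OF sub[OF p], of t x] t by simp
          then show "m (t *\<^sub>R x) / t \<le> p x" using t by (simp add: field_simps)
        qed
        then show "m (t *\<^sub>R x) \<le> t * m x" using t by (simp add: field_simps)
      qed
      moreover have "m x \<le> q x" for x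
        using False m_le le by (meson ex_in_conv order_trans)
      ultimately have "m \<in> Q" by (simp add: Q_def)
      with m_le show ?thesis by (auto simp: P_def)
    qed
  qed
  then obtain m where m: "m \<in> Q" "\<And>p. p \<in> Q \<Longrightarrow> P m p \<Longrightarrow> p = m" by blast
  show ?thesis
  proof (rule that[of m])
    show "p = m" if p: "sublinear p" and le: "\<And>x. p x \<le> m x" for p
    proof (rule m(2))
      have "p x \<le> q x" for x
        using le[of x] m(1) by (auto simp: Q_def intro: order_trans)
      with p show "p \<in> Q" by (simp add: Q_def)
      show "P m p" using le by (simp add: P_def)
    qed
  qed (use m(1) in \<open>simp_all add: Q_def\<close>)
qed

text \<open>
  Lowering \<open>m\<close> as far as possible at \<open>- y\<close> changes nothing, by minimality, so \<open>m\<close> is odd; an odd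
  sublinear functional is linear.
\<close>

lemma minimal_sublinear_imp_linear:
  fixes m :: "'a::real_vector \<Rightarrow> real"
  assumes m: "sublinear m"
    and minimal: "\<And>p. sublinear p \<Longrightarrow> (\<And>x. p x \<le> m x) \<Longrightarrow> p = m"
  shows "linear m"
proof -
  have odd: "m (- y) = - m y" for y
  proof -
    obtain p where "sublinear p" "\<And>x. p x \<le> m x" "p (- y) \<le> - m y"
      using sublinear_below_on_convex[OF m, of "{y}" "m y"] by auto
    with minimal have "m (- y) \<le> - m y" by blast
    with sublinear_minus_le[OF m, of y] show ?thesis by linarith
  qed
  show ?thesis
  proof (rule linearI)
    show "m (x + y) = m x + m y" for x y
      using sublinear_add[OF m, of x y] sublinear_diff_le[OF m, of y x] odd[of x] by linarith
    show "m (t *\<^sub>R x) = t *\<^sub>R m x" for t x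
    proof (cases "0 \<le> t")
      case True
      then show ?thesis by (simp add: sublinear_scale[OF m])
    next
      case False
      then show ?thesis
        using sublinear_scale[OF m, of "- t" x] odd[of "t *\<^sub>R x"] by simp
    qed
  qed
qed

text \<open>
  The Hahn--Banach theorem in Mazur--Orlicz form: a lower bound for \<open>q\<close> on a convex set is inherited
  by some linear functional dominated by \<open>q\<close>.
\<close>

lemma mazur_orlicz:
  fixes q :: "'a::real_vector \<Rightarrow> real"
  assumes q: "sublinear q" and "convex D" "D \<noteq> {}" and "\<And>y. y \<in> D \<Longrightarrow> c \<le> q y"
  obtains f where "linear f" "\<And>x. f x \<le> q x" "\<And>y. y \<in> D \<Longrightarrow> c \<le> f y"
proof -
  obtain p where p: "sublinear p" "\<And>x. p x \<le> q x" "\<And>y. y \<in> D \<Longrightarrow> p (- y) \<le> - c"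
    using sublinear_below_on_convex[OF assms] by blast
  obtain f where f: "sublinear f" "\<And>x. f x \<le> p x"
      "\<And>g. sublinear g \<Longrightarrow> (\<And>x. g x \<le> f x) \<Longrightarrow> g = f"
    using ex_minimal_sublinear[OF p(1)] by blast
  have lin: "linear f" using f minimal_sublinear_imp_linear by blast
  show ?thesis
  proof (rule that[OF lin])
    show "f x \<le> q x" for x using f(2) p(2) order_trans by blast
    show "c \<le> f y" if "y \<in> D" for y
      using f(2)[of "- y"] p(3)[OF that] linear_neg[OF lin, of y] by linarith
  qed
qed

section \<open>Separation and weak compactness in normed spaces\<close>

lemma blinfun_bounded_below_on_convex:
  fixes D :: "'a::real_normed_vector set"
  assumes "convex D" "D \<noteq> {}" and "\<And>y. y \<in> D \<Longrightarrow> c \<le> norm y"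
  obtains w :: "'a \<Rightarrow>\<^sub>L real" where "norm w \<le> 1" "\<And>y. y \<in> D \<Longrightarrow> c \<le> blinfun_apply w y"
proof -
  obtain f :: "'a \<Rightarrow> real" where f: "linear f" "\<And>x. f x \<le> norm x" "\<And>y. y \<in> D \<Longrightarrow> c \<le> f y"
    using mazur_orlicz[OF sublinear_norm assms] by blast
  have fb: "\<bar>f x\<bar> \<le> norm x" for x
    using f(2)[of x] f(2)[of "- x"] linear_neg[OF f(1), of x] by simp
  have bl: "bounded_linear f"
    using f(1) fb by (intro linear_conv_bounded_linear[THEN iffD1] bounded_linear.intro bounded_linear_axioms.intro)
       (auto intro!: exI[of _ 1])
  show ?thesis
  proof (rule that[of "Blinfun f"])
    show "norm (Blinfun f) \<le> 1"
      by (rule norm_blinfun_bound) (auto simp: bounded_linear_Blinfun_apply bl fb)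
    show "c \<le> blinfun_apply (Blinfun f) y" if "y \<in> D" for y
      using f(3)[OF that] by (simp add: bounded_linear_Blinfun_apply bl)
  qed
qed

lemma blinfun_separates_point_closed_convex:
  fixes F :: "'a::real_normed_vector set"
  assumes "closed F" "convex F" "F \<noteq> {}" "x \<notin> F"
  obtains w :: "'a \<Rightarrow>\<^sub>L real" and d
  where "0 < d" "\<And>y. y \<in> F \<Longrightarrow> blinfun_apply w x + d \<le> blinfun_apply w y"
proof -
  have "open (- F)" "x \<in> - F" using assms by auto
  then obtain d where d: "0 < d" "ball x d \<subseteq> - F" by (meson openE)
  \<comment> \<open>The translate of \<open>F\<close> that moves \<open>x\<close> to the origin keeps distance \<open>d\<close> from the origin.\<close>
  have "convex ((\<lambda>y. y - x) ` F)" "(\<lambda>y. y - x) ` F \<noteq> {}"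
    using assms by simp_all
  moreover have "d \<le> norm z" if "z \<in> (\<lambda>y. y - x) ` F" for z
    using that d by (force simp: dist_norm norm_minus_commute not_le[symmetric])
  ultimately obtain w :: "'a \<Rightarrow>\<^sub>L real"
    where w: "\<And>z. z \<in> (\<lambda>y. y - x) ` F \<Longrightarrow> d \<le> blinfun_apply w z"
    using blinfun_bounded_below_on_convex by metis
  show ?thesis
  proof (rule that[OF d(1)])
    show "blinfun_apply w x + d \<le> blinfun_apply w y" if "y \<in> F" for y
      using w[of "y - x"] that by (simp add: blinfun.diff_right)
  qed
qed

text \<open>The norm is determined by the unit ball of the dual space.\<close>

lemma norm_le_if_blinfun_le:
  fixes x :: "'a::real_normed_vector"
  assumes "\<And>w :: 'a \<Rightarrow>\<^sub>L real. norm w \<le> 1 \<Longrightarrow> blinfun_apply w x \<le> b"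
  shows "norm x \<le> b"
proof -
  obtain w :: "'a \<Rightarrow>\<^sub>L real" where "norm w \<le> 1" "norm x \<le> blinfun_apply w x"
    using blinfun_bounded_below_on_convex[of "{x}" "norm x"] by auto
  with assms show ?thesis by (meson order_trans)
qed

text \<open>
  Weak compactness is expressed by the canonical embedding into the functions on the dual space,
  which carry the topology of pointwise convergence. The image of \<open>S\<close> lies in a product of compact
  intervals. A pointwise limit of evaluations is again linear and bounded, hence an evaluation at
  some \<open>x\<close> by reflexivity, and separation places \<open>x\<close> in \<open>S\<close>.
\<close>

lemma weakly_compact_closed_bounded_convex:
  fixes S :: "'a::real_normed_vector set"
  assumes refl: "reflexive_space TYPE('a)"
    and "closed S" "bounded S" "convex S"
  shows "compact ((\<lambda>x (w :: 'a \<Rightarrow>\<^sub>L real). blinfun_apply w x) ` S)"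
proof (cases "S = {}")
  case False
  obtain R where R: "\<And>x. x \<in> S \<Longrightarrow> norm x \<le> R"
    using \<open>bounded S\<close> by (auto simp: bounded_iff)
  let ?B = "\<Pi>\<^sub>E (w :: 'a \<Rightarrow>\<^sub>L real)\<in>UNIV. {- (norm w * R)..norm w * R}"
  let ?J = "(\<lambda>x (w :: 'a \<Rightarrow>\<^sub>L real). blinfun_apply w x) ` S"
  have J_bound: "\<bar>blinfun_apply w x\<bar> \<le> norm w * R" if "x \<in> S" for x and w :: "'a \<Rightarrow>\<^sub>L real"
  proof -
    have "\<bar>blinfun_apply w x\<bar> \<le> norm w * norm x"
      using norm_blinfun[of w x] by simp
    also have "\<dots> \<le> norm w * R"
      using R[OF that] by (rule mult_left_mono) simp
    finally show ?thesis .
  qed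
  have B: "compact ?B"
    using compactin_PiE[of "\<lambda>_ :: 'a \<Rightarrow>\<^sub>L real. euclideanreal" UNIV "\<lambda>w. {- (norm w * R)..norm w * R}"]
    by (simp add: euclidean_product_topology)
  have JB: "?J \<subseteq> ?B"
  proof (rule image_subsetI, rule PiE_I)
    show "blinfun_apply w x \<in> {- (norm w * R)..norm w * R}" if "x \<in> S" for x w
      using J_bound[OF that, of w] by (simp add: abs_le_iff)
  qed simp
  have J: "closed ?J"
  proof (rule closure_subset_eq[THEN iffD1], rule subsetI)
    fix \<phi> assume \<phi>: "\<phi> \<in> closure ?J"
    have limit: "\<phi> \<in> E" if "closed E" "?J \<subseteq> E" for E
      using \<phi> that closure_minimal by blast
    have "\<phi> \<in> {\<psi>. \<psi> (v + w) = \<psi> v + \<psi> w}" for v w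
      by (rule limit) (auto intro!: closed_Collect_eq continuous_intros simp: blinfun.add_left)
    then have add: "\<phi> (v + w) = \<phi> v + \<phi> w" for v w by blast
    have "\<phi> \<in> {\<psi>. \<psi> (t *\<^sub>R w) = t * \<psi> w}" for t w
      by (rule limit) (auto intro!: closed_Collect_eq continuous_intros simp: blinfun.scaleR_left)
    then have scale: "\<phi> (t *\<^sub>R w) = t * \<phi> w" for t w by blast
    have "\<phi> \<in> {\<psi>. \<bar>\<psi> w\<bar> \<le> norm w * R}" for w
    proof (rule limit)
      show "closed {\<psi> :: ('a \<Rightarrow>\<^sub>L real) \<Rightarrow> real. \<bar>\<psi> w\<bar> \<le> norm w * R}"
        by (intro closed_Collect_le continuous_intros) simp
      show "?J \<subseteq> {\<psi>. \<bar>\<psi> w\<bar> \<le> norm w * R}"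
        using J_bound by blast
    qed
    then have bound: "\<bar>\<phi> w\<bar> \<le> norm w * R" for w by (rule CollectD)
    have bl: "bounded_linear \<phi>"
      by (rule bounded_linear_intro[where K = R]) (auto simp: add scale bound)
    obtain x where "blinfun_apply (Blinfun \<phi>) w = blinfun_apply w x" for w
      using refl unfolding reflexive_space_def by meson
    then have x: "\<phi> w = blinfun_apply w x" for w
      by (simp add: bounded_linear_Blinfun_apply bl)
    have "x \<in> S"
    proof (rule ccontr)
      assume "x \<notin> S"
      then obtain w :: "'a \<Rightarrow>\<^sub>L real" and d
        where w: "0 < d" "\<And>y. y \<in> S \<Longrightarrow> blinfun_apply w x + d \<le> blinfun_apply w y"
        using blinfun_separates_point_closed_convex[OF assms(2,4) False] by metis
      have "\<phi> \<in> {\<psi>. blinfun_apply w x + d \<le> \<psi> w}"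
        using w by (intro limit) (auto intro!: closed_Collect_le continuous_intros)
      with x[of w] w(1) show False by simp
    qed
    with x show "\<phi> \<in> ?J" by (intro image_eqI[of _ _ x]) (rule ext)
  qed
  show ?thesis
    using compact_Int_closed[OF B J] unfolding Int_absorb1[OF JB] .
qed simp

section \<open>Minimax for finitely many strategies\<close>

lemma two_point_minimax:
  fixes f g :: "'a::real_vector \<Rightarrow> real"
  assumes "linear f" "linear g" "convex S"
    and mix: "\<And>a b. 0 \<le> a \<Longrightarrow> 0 \<le> b \<Longrightarrow> a + b = 1 \<Longrightarrow> \<exists>x\<in>S. c < a * f x + b * g x"
  obtains x where "x \<in> S" "c < f x" "c < g x"
proof (rule ccontr)
  assume "\<not> thesis"
  then have no: "\<forall>x\<in>S. f x \<le> c \<or> g x \<le> c"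
    using that by (meson not_le)
  \<comment> \<open>By \<open>no\<close>, this sublinear functional is at least \<open>- c\<close> on the negated payoff pairs. A linear
    functional below it is a convex combination of the coordinates.\<close>
  define q where "q z = max (fst z) (snd z)" for z :: "real \<times> real"
  let ?D = "(\<lambda>x. - (f x, g x)) ` S"
  have "linear (\<lambda>x. - (f x, g x))"
    using assms(1,2) by (auto simp: linear_iff)
  then have "convex ?D" using \<open>convex S\<close> by (rule convex_linear_image)
  moreover have "?D \<noteq> {}" using mix[of 1 0] by auto
  moreover have "sublinear q"
    by (auto simp: sublinear_def q_def max_mult_distrib_left)
  moreover have "- c \<le> q z" if "z \<in> ?D" for z
    using that no by (auto simp: q_def)
  ultimately obtain l where l: "linear l" "\<And>z. l z \<le> q z" "\<And>z. z \<in> ?D \<Longrightarrow> - c \<le> l z"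
    using mazur_orlicz by blast
  define a b where "a = l (1, 0)" and "b = l (0, 1)"
  have l_eq: "l (s, t) = s * a + t * b" for s t
  proof -
    have "l (s, t) = l (s *\<^sub>R (1, 0) + t *\<^sub>R (0, 1))" by simp
    also have "\<dots> = s * a + t * b"
      unfolding linear_add[OF l(1)] linear_scale[OF l(1)] by (simp add: a_def b_def)
    finally show ?thesis .
  qed
  have "0 \<le> a" "0 \<le> b" "a + b = 1"
    using l(2)[of "(-1, 0)"] l(2)[of "(0, -1)"] l(2)[of "(1, 1)"] l(2)[of "(-1, -1)"]
    by (auto simp: l_eq q_def)
  with mix obtain x where x: "x \<in> S" "c < a * f x + b * g x" by blast
  with l(3)[of "- (f x, g x)"] show False
    by (simp add: l_eq algebra_simps)
qed

text \<open>
  In the induction step \<open>S\<close> shrinks to the strategies that beat \<open>c\<close> against the new \<open>y0\<close>; the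
  hypothesis survives on this smaller set by the case of two strategies.
\<close>

lemma finite_minimax:
  fixes G :: "'b::real_vector \<Rightarrow> 'a::real_vector \<Rightarrow> real"
  assumes "finite Y" "Y \<noteq> {}" "convex S"
    and lin: "\<And>y. linear (G y)" and lin': "\<And>x. linear (\<lambda>y. G y x)"
    and mix: "\<And>y. y \<in> convex hull Y \<Longrightarrow> \<exists>x\<in>S. c < G y x"
  shows "\<exists>x\<in>S. \<forall>y\<in>Y. c < G y x"
  using assms(1,2,3) mix
proof (induction Y arbitrary: S rule: finite_ne_induct)
  case (singleton y)
  then show ?case by simp
next
  case (insert y0 Y)
  let ?S = "{x\<in>S. c < G y0 x}"
  have "\<exists>x\<in>?S. \<forall>y\<in>Y. c < G y x"
  proof (rule insert.IH)
    have "?S = S \<inter> G y0 -` {c<..}" by auto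
    also have "convex \<dots>"
      by (intro convex_Int convex_linear_vimage insert.prems lin) auto
    finally show "convex ?S" .
  next
    fix y assume y: "y \<in> convex hull Y"
    obtain x where "x \<in> S" "c < G y0 x" "c < G y x"
    proof (rule two_point_minimax[OF lin lin \<open>convex S\<close>])
      fix a b :: real assume ab: "0 \<le> a" "0 \<le> b" "a + b = 1"
      have "y0 \<in> convex hull insert y0 Y" by (simp add: hull_inc)
      moreover have "y \<in> convex hull insert y0 Y"
        using y hull_mono[of Y "insert y0 Y"] by blast
      ultimately have "a *\<^sub>R y0 + b *\<^sub>R y \<in> convex hull insert y0 Y"
        using ab by (intro convexD convex_convex_hull)
      then obtain x where "x \<in> S" "c < G (a *\<^sub>R y0 + b *\<^sub>R y) x"
        using insert.prems by blast
      then show "\<exists>x\<in>S. c < a * G y0 x + b * G y x"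
        using linear_add[OF lin'[of x]] linear_scale[OF lin'[of x]] by auto
    qed
    then show "\<exists>x\<in>?S. c < G y x" by blast
  qed
  then show ?case by auto
qed

section \<open>Optimal strategies\<close>

text \<open>
  The weakly closed conditions are indexed by pairs of an opposing strategy \<open>y\<close> and a level
  \<open>c' < c\<close>. Finitely many of them are met simultaneously by \<open>finite_minimax\<close> at the largest of the
  levels, so all of them are met by weak compactness.
\<close>

lemma ex_guaranteeing_strategy:
  fixes S :: "'a::real_normed_vector set" and T :: "'b::real_vector set"
    and G :: "'b \<Rightarrow> 'a \<Rightarrow>\<^sub>L real"
  assumes "reflexive_space TYPE('a)" "closed S" "bounded S" "convex S"
    and "convex T" "S \<noteq> {}" and lin: "\<And>x. linear (\<lambda>y. blinfun_apply (G y) x)"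
    and val: "\<And>y c'. y \<in> T \<Longrightarrow> c' < c \<Longrightarrow> \<exists>x\<in>S. c' < blinfun_apply (G y) x"
  shows "\<exists>x\<in>S. \<forall>y\<in>T. c \<le> blinfun_apply (G y) x"
proof -
  let ?J = "\<lambda>x (w :: 'a \<Rightarrow>\<^sub>L real). blinfun_apply w x"
  have "?J ` S \<inter> (\<Inter>i\<in>T \<times> {..<c}. {\<psi>. snd i \<le> \<psi> (G (fst i))}) \<noteq> {}"
  proof (rule compact_imp_fip_image)
    show "compact (?J ` S)"
      using assms by (intro weakly_compact_closed_bounded_convex)
    show "closed {\<psi> :: ('a \<Rightarrow>\<^sub>L real) \<Rightarrow> real. snd i \<le> \<psi> (G (fst i))}" for i
      by (auto intro!: closed_Collect_le continuous_intros)
    fix I assume I: "finite I" "I \<subseteq> T \<times> {..<c}"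
    show "?J ` S \<inter> (\<Inter>i\<in>I. {\<psi>. snd i \<le> \<psi> (G (fst i))}) \<noteq> {}"
    proof (cases "I = {}")
      case False
      define m where "m = Max (snd ` I)"
      have m: "snd i \<le> m" if "i \<in> I" for i using that I by (auto simp: m_def)
      have "m \<in> snd ` I" using I False by (auto simp: m_def intro!: Max_in)
      then have "m < c" using I by auto
      have "\<exists>x\<in>S. \<forall>y\<in>fst ` I. m < blinfun_apply (G y) x"
      proof (rule finite_minimax)
        have "convex hull (fst ` I) \<subseteq> T"
          using I \<open>convex T\<close> by (intro hull_minimal) auto
        then show "\<exists>x\<in>S. m < blinfun_apply (G y) x" if "y \<in> convex hull (fst ` I)" for y
          using that val \<open>m < c\<close> by blast
        show "linear (blinfun_apply (G y))" for y
          by (simp add: bounded_linear.linear blinfun.bounded_linear_right)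
      qed (use I False assms in auto)
      then obtain x where "x \<in> S" "\<And>i. i \<in> I \<Longrightarrow> m < blinfun_apply (G (fst i)) x" by auto
      then have "?J x \<in> ?J ` S \<inter> (\<Inter>i\<in>I. {\<psi>. snd i \<le> \<psi> (G (fst i))})"
        using m by (fastforce intro: less_imp_le order_le_less_trans)
      then show ?thesis by blast
    qed (use \<open>S \<noteq> {}\<close> in auto)
  qed
  then obtain x where "x \<in> S" "\<forall>y\<in>T. \<forall>c'<c. c' \<le> blinfun_apply (G y) x"
    by fastforce
  then show ?thesis by (meson dense_le)
qed

lemma convex_cone_strategies:
  assumes "convex C"
  shows "convex (cone_strategies C \<alpha>)"
proof -
  have "cone_strategies C \<alpha> = C \<inter> blinfun_apply \<alpha> -` {1}"
    by (auto simp: cone_strategies_def)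
  then show ?thesis
    using assms by (auto intro!: convex_Int convex_linear_vimage
        simp: bounded_linear.linear blinfun.bounded_linear_right)
qed

lemma closed_cone_strategies:
  assumes "closed C"
  shows "closed (cone_strategies C \<alpha>)"
proof -
  have "cone_strategies C \<alpha> = C \<inter> {x. blinfun_apply \<alpha> x = 1}"
    by (auto simp: cone_strategies_def)
  then show ?thesis
    using assms by (auto intro!: closed_Int closed_Collect_eq continuous_intros)
qed

lemma bounded_cone_strategies:
  assumes "\<alpha> \<in> interior (dual_cone C)"
  shows "bounded (cone_strategies C \<alpha>)"
proof -
  obtain e where e: "0 < e" "cball \<alpha> e \<subseteq> dual_cone C"
    using assms by (meson mem_interior_cball)
  have "norm x \<le> 1 / e" if x: "x \<in> cone_strategies C \<alpha>" for x
  proof (rule norm_le_if_blinfun_le)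
    fix w :: "'a \<Rightarrow>\<^sub>L real" assume "norm w \<le> 1"
    then have "\<alpha> - e *\<^sub>R w \<in> cball \<alpha> e" using e by (simp add: dist_norm)
    with e have "\<alpha> - e *\<^sub>R w \<in> dual_cone C" by blast
    with x have "0 \<le> blinfun_apply (\<alpha> - e *\<^sub>R w) x" "blinfun_apply \<alpha> x = 1"
      by (auto simp: dual_cone_def cone_strategies_def)
    then show "blinfun_apply w x \<le> 1 / e"
      using e by (simp add: blinfun.diff_left blinfun.scaleR_left field_simps)
  qed
  then show ?thesis by (auto simp: bounded_iff)
qed

theorem theorem3p2:
  fixes C :: "'a::banach set" and K :: "'b::banach set"
    and \<alpha> :: "'a \<Rightarrow>\<^sub>L real" and \<beta> :: "'b \<Rightarrow>\<^sub>L real"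
    and A :: "'a \<Rightarrow> ('b \<Rightarrow>\<^sub>L real)"
    and S :: "'a set" and T :: "'b set" and u :: "'a \<Rightarrow> 'b \<Rightarrow> real"
  assumes "reflexive_space TYPE('a)" and "reflexive_space TYPE('b)"
    and "closed C" and "cone C" and "convex C"
    and "closed K" and "cone K" and "convex K"
    and "interior (dual_cone C) \<noteq> {}" and "interior (dual_cone K) \<noteq> {}"
    and "linear A" and "has_adjoint A"
    and "\<alpha> \<in> interior (dual_cone C)" and "\<beta> \<in> interior (dual_cone K)"
    and S_def: "S = cone_strategies C \<alpha>" and T_def: "T = cone_strategies K \<beta>"
    and u_def: "u = payoff A"
    and "S \<noteq> {}" and "T \<noteq> {}"
    and "\<bar>lower_value S T u\<bar> \<noteq> \<infinity>" and "\<bar>upper_value S T u\<bar> \<noteq> \<infinity>"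
  shows "lower_value S T u = upper_value S T u \<and>
    nash_equilibria S T u = optimal_I S T u \<times> optimal_II S T u \<and>
    optimal_I S T u \<times> optimal_II S T u \<noteq> {} \<and>
    convex (optimal_I S T u \<times> optimal_II S T u) \<and>
    bounded (optimal_I S T u \<times> optimal_II S T u)"
proof -
  have lin: "linear (\<lambda>x. u x y)" "linear (u x)" for x y
    using \<open>linear A\<close>
    by (auto simp: u_def payoff_def linear_iff blinfun.add_left blinfun.scaleR_left
        blinfun.add_right blinfun.scaleR_right)
  \<comment> \<open>\<open>G\<close> is the adjoint of \<open>A\<close>; the first player's payoff is the pairing with \<open>G y\<close>.\<close>
  obtain G :: "'b \<Rightarrow> 'a \<Rightarrow>\<^sub>L real" where G: "blinfun_apply (G y) x = u x y" for x y
    using \<open>has_adjoint A\<close> unfolding has_adjoint_def u_def payoff_def by metis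
  have S: "closed S" "bounded S" "convex S"
    using assms by (simp_all add: closed_cone_strategies bounded_cone_strategies convex_cone_strategies)
  have T: "closed T" "bounded T" "convex T"
    using assms by (simp_all add: closed_cone_strategies bounded_cone_strategies convex_cone_strategies)
  have le: "lower_value S T u \<le> upper_value S T u"
    unfolding lower_value_def upper_value_def
    by (intro SUP_least INF_greatest order_trans[OF INF_lower SUP_upper]) auto
  obtain v where v: "upper_value S T u = ereal v"
    using assms(21) by (cases "upper_value S T u") auto
  have "\<exists>x\<in>S. \<forall>y\<in>T. v \<le> blinfun_apply (G y) x"
  proof (rule ex_guaranteeing_strategy[OF assms(1) S T(3) \<open>S \<noteq> {}\<close>])
    show "linear (\<lambda>y. blinfun_apply (G y) x)" for x by (simp add: G lin)
    fix y c' assume "y \<in> T" "c' < v"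
    then have "ereal c' < (SUP x\<in>S. ereal (u x y))"
      using v unfolding upper_value_def by (metis INF_lower less_ereal.simps(1) order_less_le_trans)
    then show "\<exists>x\<in>S. c' < blinfun_apply (G y) x" by (auto simp: less_SUP_iff G)
  qed
  then obtain x0 where x0: "x0 \<in> S" "\<And>y. y \<in> T \<Longrightarrow> v \<le> u x0 y" by (auto simp: G)
  have "ereal v \<le> (INF y\<in>T. ereal (u x0 y))"
    using x0 by (auto intro: INF_greatest)
  also have "\<dots> \<le> lower_value S T u"
    unfolding lower_value_def using x0(1) by (rule SUP_upper)
  finally have eq: "lower_value S T u = ereal v" using le v by simp
  \<comment> \<open>The second player maximizes \<open>- u\<close>, which is the pairing with \<open>- A x\<close>.\<close>
  have "\<exists>y\<in>T. \<forall>x\<in>S. - v \<le> blinfun_apply (- A x) y"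
  proof (rule ex_guaranteeing_strategy[OF assms(2) T S(3) \<open>T \<noteq> {}\<close>])
    show "linear (\<lambda>x. blinfun_apply (- A x) y)" for y
      using linear_compose_neg[OF lin(1)[of y]]
      by (simp add: u_def payoff_def blinfun.minus_left)
    fix x c' assume "x \<in> S" "c' < - v"
    then have "(INF y\<in>T. ereal (u x y)) < ereal (- c')"
      using eq unfolding lower_value_def
      by (metis SUP_upper less_ereal.simps(1) minus_less_iff minus_minus order_le_less_trans)
    then show "\<exists>y\<in>T. c' < blinfun_apply (- A x) y"
      by (force simp: INF_less_iff u_def payoff_def blinfun.minus_left)
  qed
  then obtain y0 where y0: "y0 \<in> T" "\<And>x. x \<in> S \<Longrightarrow> u x y0 \<le> v"
    by (auto simp: u_def payoff_def blinfun.minus_left)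
  have gv: "game_value S T u = v"
    unfolding game_value_def using eq v by (intro the_equality) auto
  have nash: "nash_equilibria S T u = optimal_I S T u \<times> optimal_II S T u"
  proof (intro set_eqI iffI)
    fix p assume "p \<in> nash_equilibria S T u"
    then obtain x y where p: "p = (x, y)" "x \<in> S" "y \<in> T"
        "\<And>y'. y' \<in> T \<Longrightarrow> u x y \<le> u x y'" "\<And>x'. x' \<in> S \<Longrightarrow> u x' y \<le> u x y"
      using \<open>S \<noteq> {}\<close> \<open>T \<noteq> {}\<close> by (auto simp: nash_equilibria_def)
    have "u x y = v"
      using x0(2)[OF p(3)] p(5)[OF x0(1)] y0(2)[OF p(2)] p(4)[OF y0(1)] by linarith
    with p show "p \<in> optimal_I S T u \<times> optimal_II S T u"
      by (auto simp: optimal_I_def optimal_II_def gv)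
  next
    fix p assume "p \<in> optimal_I S T u \<times> optimal_II S T u"
    then obtain x y where p: "p = (x, y)" "x \<in> S" "y \<in> T"
        "\<And>y'. y' \<in> T \<Longrightarrow> v \<le> u x y'" "\<And>x'. x' \<in> S \<Longrightarrow> u x' y \<le> v"
      by (auto simp: optimal_I_def optimal_II_def gv)
    with p(4)[OF p(3)] p(5)[OF p(2)] show "p \<in> nash_equilibria S T u"
      by (force simp: nash_equilibria_def)
  qed
  have nonempty: "x0 \<in> optimal_I S T u" "y0 \<in> optimal_II S T u"
    using x0 y0 by (auto simp: optimal_I_def optimal_II_def gv)
  have "optimal_I S T u = S \<inter> (\<Inter>y\<in>T. (\<lambda>x. u x y) -` {v..})"
    by (auto simp: optimal_I_def gv)
  then have "convex (optimal_I S T u)"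
    using S by (auto intro!: convex_Int convex_INT convex_linear_vimage lin)
  moreover have "optimal_II S T u = T \<inter> (\<Inter>x\<in>S. u x -` {..v})"
    by (auto simp: optimal_II_def gv)
  then have "convex (optimal_II S T u)"
    using T by (auto intro!: convex_Int convex_INT convex_linear_vimage lin)
  ultimately have conv: "convex (optimal_I S T u \<times> optimal_II S T u)"
    by (rule convex_Times)
  have "bounded (optimal_I S T u \<times> optimal_II S T u)"
    using S T by (auto intro!: bounded_Times bounded_subset[of S] bounded_subset[of T]
        simp: optimal_I_def optimal_II_def)
  with eq v nash nonempty conv show ?thesis by auto
qed

end
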